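(* Let $G_1$ and $G_2$ be two disjoint finite simple bipartite graphs, let $w$ be a vertex of $G_2$ and let $v$ be a vertex of $G_1$. If $G_1\cup(G_2-w)\succeq G_2\cup(G_1-v)$, then $\mathcal{E}_{G_2}(w)\leq\mathcal{E}_{G_1}(v)$.
   Context: For a graph $G$ with vertices $v_1,\dots,v_n$ and adjacency matrix $A$, the energy of the vertex $v_i$ is $\mathcal{E}_G(v_i)=|A|_{ii}$, the $i$-th diagonal entry of $|A|=(AA^* )^{1/2}$. $G-v$ denotes the graph obtained from $G$ by removing $v$ and all edges containing it, and $\cup$ denotes disjoint union of graphs. For a bipartite graph $H$ of order $m$ with adjacency matrix $A(H)$, the characteristic polynomial $\phi(H;x)=\det(xI_m-A(H))$ has the form $\sum_{k\ge 0}(-1)^k b_{2k}(H)x^{m-2k}$ with $b_{2k}(H)\ge 0$ for all $k$ (and $b_{2k}(H)=0$ for $2k>m$). The quasi-order is defined on bipartite graphs by: $H_1\preceq H_2$ (equivalently $H_2\succeq H_1$) iff $b_{2k}(H_1)\le b_{2k}(H_2)$ for all $k$. *)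

theory Defs
  imports
    "Graph_Theory.Graph_Theory"
    "Jordan_Normal_Form.Char_Poly"
    "Jordan_Normal_Form.Schur_Decomposition"
begin

definition bipartite :: "('a, 'b) pre_digraph \<Rightarrow> bool" where
  "bipartite G \<longleftrightarrow> (\<exists>U W. verts G = U \<union> W \<and> U \<inter> W = {} \<and>
     arcs_ends G \<subseteq> U \<times> W \<union> W \<times> U)"

text \<open>The numbering \<open>v\<^sub>1, \<dots>, v\<^sub>n\<close> of the vertices behind the adjacency matrix. It is an arbitrary
  but fixed one: renumbering conjugates the adjacency matrix by a permutation matrix, which changes
  neither the characteristic polynomial nor the energy of a given vertex.\<close>

definition vertex_list :: "('a, 'b) pre_digraph \<Rightarrow> 'a list" where
  "vertex_list G = (SOME vs. distinct vs \<and> set vs = verts G)"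

definition adjacency_mat :: "('a, 'b) pre_digraph \<Rightarrow> real mat" where
  "adjacency_mat G = (let vs = vertex_list G; n = length vs in
     mat n n (\<lambda>(i, j). if (vs ! i, vs ! j) \<in> arcs_ends G then 1 else 0))"

definition positive_semidefinite :: "real mat \<Rightarrow> bool" where
  "positive_semidefinite P \<longleftrightarrow> square_mat P \<and> mat_adjoint P = P \<and>
     (\<forall>x \<in> carrier_vec (dim_row P). 0 \<le> x \<bullet> (P *\<^sub>v x))"

text \<open>The square root of a positive semidefinite matrix; only meaningful for such arguments.\<close>

definition psd_sqrt :: "real mat \<Rightarrow> real mat" where
  "psd_sqrt B = (THE P. positive_semidefinite P \<and> P * P = B)"

definition abs_mat :: "real mat \<Rightarrow> real mat" where
  "abs_mat A = psd_sqrt (A * mat_adjoint A)"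

definition vertex_energy :: "('a, 'b) pre_digraph \<Rightarrow> 'a \<Rightarrow> real" where
  "vertex_energy G v =
     (let i = (THE i. i < length (vertex_list G) \<and> vertex_list G ! i = v)
      in abs_mat (adjacency_mat G) $$ (i, i))"

definition graph_char_poly :: "('a, 'b) pre_digraph \<Rightarrow> real poly" where
  "graph_char_poly H = char_poly (adjacency_mat H)"

text \<open>\<open>b_even H k\<close> is the coefficient \<open>b\<^bsub>2k\<^esub>(H)\<close> in
  \<open>\<phi>(H; x) = (\<Sum>k. (-1)^k * b\<^bsub>2k\<^esub>(H) * x^(m - 2k))\<close>, where \<open>m\<close> is the order of the bipartite graph
  \<open>H\<close>. The case distinction is needed because subtraction on \<open>nat\<close> truncates.\<close>

definition b_even :: "('a, 'b) pre_digraph \<Rightarrow> nat \<Rightarrow> real" where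
  "b_even H k = (let m = card (verts H) in
     if 2 * k \<le> m then (-1) ^ k * coeff (graph_char_poly H) (m - 2 * k) else 0)"

text \<open>The quasi-order; it is meant to be used between bipartite graphs only.\<close>

definition quasi_le :: "('a, 'b) pre_digraph \<Rightarrow> ('c, 'd) pre_digraph \<Rightarrow> bool"
    (infix \<open>\<preceq>\<^sub>b\<close> 50) where
  "H\<^sub>1 \<preceq>\<^sub>b H\<^sub>2 \<longleftrightarrow> (\<forall>k. b_even H\<^sub>1 k \<le> b_even H\<^sub>2 k)"

end

theory Submission
  imports Defs
begin

text \<open>
The argument is Coulson's integral formula, localised at a vertex. Diagonalise the adjacency
matrix of \<open>G\<close> (\<open>spectral_theorem_real_symmetric\<close>), let \<open>d\<^sub>k\<close> be the eigenvalues and let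
\<open>p\<^sub>k\<close> be the squared entries of the orthonormal eigenvectors at the vertex \<open>v\<close>. Then the energy of
\<open>v\<close> is \<open>\<Sum> p\<^sub>k \<bar>d\<^sub>k\<bar>\<close> (\<open>abs_mat_diagonal_entry\<close>), where uniqueness of the positive
semidefinite square root makes sense of \<open>|A|\<close>. On the other hand the resolvent entry
at \<open>v\<close> gives \<open>\<phi>(G - v; z) / \<phi>(G; z) = \<Sum> p\<^sub>k / (z - d\<^sub>k)\<close> (\<open>char_poly_ratio\<close>).

For a bipartite graph of order \<open>n\<close> the rotated polynomial \<open>q(x) = \<phi>(\<i> x) / \<i>\<^sup>n\<close> is real, has the
coefficients \<open>b\<^bsub>2k\<^esub>\<close>, and is positive for \<open>x > 0\<close>. Write \<open>q\<^sub>v\<close> for the rotated polynomial of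
\<open>G - v\<close>. Evaluating the resolvent identity at \<open>z = \<i> x\<close> gives
\<open>q\<^sub>v(x) / q(x) = \<Sum> p\<^sub>k x / (x\<^sup>2 + d\<^sub>k\<^sup>2)\<close> (\<open>rotated_char_poly_ratio\<close>). Characteristic
polynomials are multiplicative over disjoint unions, so the quasi-order hypothesis compares, coefficient by
coefficient, the product of the rotated polynomials of \<open>G2\<close> and \<open>G1 - v\<close> with that of \<open>G1\<close> and
\<open>G2 - w\<close>. Dividing by the rotated polynomials of \<open>G1\<close> and \<open>G2\<close> shows that
\<open>\<Sum> p\<^sub>k x / (x\<^sup>2 + d\<^sub>k\<^sup>2)\<close> for \<open>G1\<close> and \<open>v\<close> is at most the corresponding sum for \<open>G2\<close> and \<open>w\<close>.

Since the weights \<open>p\<^sub>k\<close> sum to one, \<open>\<Sum> p\<^sub>k d\<^sub>k\<^sup>2 / (x\<^sup>2 + d\<^sub>k\<^sup>2)\<close> is one minus \<open>x\<close> times that sum,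
so here the inequality is reversed. Integrating over \<open>x > 0\<close> turns each summand into
\<open>p\<^sub>k \<bar>d\<^sub>k\<bar> \<pi> / 2\<close> and yields the comparison of energies (\<open>sum_abs_le_of_sum_lorentzian_le\<close>).
\<close>

section \<open>Diagonalising real symmetric matrices\<close>

lemma mat_adjoint_real: "mat_adjoint (A :: real mat) = transpose_mat A"
  unfolding mat_adjoint_def by (rule eq_matI) (auto simp: mat_of_rows_index)

text \<open>The columns of \<open>U\<close> form an orthonormal eigenbasis of \<open>A\<close>, with eigenvalues \<open>d 0, \<dots>, d (n - 1)\<close>.
Only \<open>U\<^sup>T U = 1\<close> is demanded, since \<open>U U\<^sup>T = 1\<close> follows for
square matrices.\<close>

definition spectral_decomposition :: "nat \<Rightarrow> real mat \<Rightarrow> real mat \<Rightarrow> (nat \<Rightarrow> real) \<Rightarrow> bool" where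
  "spectral_decomposition n A U d \<longleftrightarrow> U \<in> carrier_mat n n \<and> transpose_mat U * U = 1\<^sub>m n \<and>
     A = U * mat_diag n d * transpose_mat U"

lemma spectral_decompositionD:
  assumes "spectral_decomposition n A U d"
  shows "U \<in> carrier_mat n n" "transpose_mat U * U = 1\<^sub>m n" "U * transpose_mat U = 1\<^sub>m n"
    "A = U * mat_diag n d * transpose_mat U" "A \<in> carrier_mat n n"
  using assms mat_mult_left_right_inverse[of "transpose_mat U" n U]
  unfolding spectral_decomposition_def by auto

text \<open>Over the complex numbers some eigenvalue exists. It is real because the Hermitian form
\<open>x\<^sup>* A x\<close> of an eigenvector \<open>x\<close> is both self-conjugate, by symmetry of \<open>A\<close>, and the eigenvalue times
the squared length of \<open>x\<close>. A real root of the characteristic polynomial has a real eigenvector.\<close>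

lemma symmetric_has_eigenvector:
  assumes A: "(A :: real mat) \<in> carrier_mat n n" and sym: "transpose_mat A = A" and n: "0 < n"
  obtains e v where "v \<in> carrier_vec n" "v \<bullet> v = 1" "A *\<^sub>v v = e \<cdot>\<^sub>v v"
proof -
  define C where "C = map_mat complex_of_real A"
  have C: "C \<in> carrier_mat n n" using A by (simp add: C_def)
  have cp: "char_poly C = map_poly of_real (char_poly A)"
    unfolding C_def by (rule of_real_hom.char_poly_hom[OF A])
  have "degree (char_poly C) = n" using degree_monic_char_poly[OF C] by simp
  then have "\<not> constant (poly (char_poly C))" using n by (simp add: constant_degree)
  then obtain z where z: "poly (char_poly C) z = 0"
    using fundamental_theorem_of_algebra by blast
  then have "eigenvalue C z" using eigenvalue_root_char_poly[OF C] by simp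
  then obtain x where x: "x \<in> carrier_vec n" "x \<noteq> 0\<^sub>v n" "C *\<^sub>v x = z \<cdot>\<^sub>v x"
    using C unfolding eigenvalue_def eigenvector_def by auto
  define s where "s = (\<Sum>i<n. \<Sum>j<n. cnj (x $ i) * of_real (A $$ (i,j)) * x $ j)"
  define N where "N = (\<Sum>i<n. (cmod (x $ i))\<^sup>2)"
  have A_sym: "A $$ (i,j) = A $$ (j,i)" if "i < n" "j < n" for i j
    using that A arg_cong[OF sym, of "\<lambda>M. M $$ (i,j)"] by simp
  have "cnj s = (\<Sum>i<n. \<Sum>j<n. x $ i * of_real (A $$ (i,j)) * cnj (x $ j))"
    by (simp add: s_def)
  also have "\<dots> = (\<Sum>j<n. \<Sum>i<n. x $ i * of_real (A $$ (i,j)) * cnj (x $ j))"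
    by (rule sum.swap)
  also have "\<dots> = s"
    unfolding s_def by (intro sum.cong refl) (simp add: A_sym mult_ac)
  finally have s_real: "cnj s = s" .
  have "(\<Sum>j<n. of_real (A $$ (i,j)) * x $ j) = z * x $ i" if "i < n" for i
  proof -
    have "(C *\<^sub>v x) $ i = (z \<cdot>\<^sub>v x) $ i" by (simp only: x(3))
    then show ?thesis
      using that x(1) A by (simp add: C_def scalar_prod_def atLeast0LessThan)
  qed
  then have "s = (\<Sum>i<n. cnj (x $ i) * (z * x $ i))"
    unfolding s_def by (simp add: mult.assoc flip: sum_distrib_left)
  also have "\<dots> = z * of_real N"
    unfolding N_def of_real_sum sum_distrib_left
    by (intro sum.cong refl) (metis complex_norm_square mult.commute mult.left_commute)
  finally have s: "s = z * of_real N" .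
  have "N \<noteq> 0"
  proof
    assume "N = 0"
    then have "x $ i = 0" if "i < n" for i
      using that unfolding N_def by (subst (asm) sum_nonneg_eq_0_iff) auto
    then show False using x(1,2) by (auto intro!: eq_vecI)
  qed
  with s s_real have "cnj z = z" by simp
  then obtain e where e: "z = of_real e" by (metis Reals_cnj_iff Reals_cases)
  have "poly (char_poly A) e = 0"
    using z unfolding cp e by (simp add: of_real_hom.poly_map_poly)
  then obtain y where y: "y \<in> carrier_vec n" "y \<noteq> 0\<^sub>v n" "A *\<^sub>v y = e \<cdot>\<^sub>v y"
    using A eigenvalue_root_char_poly[OF A] unfolding eigenvalue_def eigenvector_def by auto
  have pos: "0 < y \<bullet> y"
    using conjugate_square_greater_0_vec[OF y(1)] y(2) by simp
  define v where "v = (1 / sqrt (y \<bullet> y)) \<cdot>\<^sub>v y"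
  have "v \<in> carrier_vec n" "v \<bullet> v = 1" "A *\<^sub>v v = e \<cdot>\<^sub>v v"
    using y A pos by (auto simp: v_def mult_mat_vec smult_smult_assoc mult.commute)
  then show thesis by (rule that)
qed

text \<open>The witness is the Householder reflection in the hyperplane orthogonal to the difference of \<open>v\<close>
and the first unit vector. Reflections are symmetric involutions, so \<open>W\<close> conjugates symmetric
matrices to symmetric ones without a separate inverse.\<close>

lemma orthogonal_mat_with_first_column:
  assumes v: "(v :: real vec) \<in> carrier_vec n" and unit: "v \<bullet> v = 1" and n: "0 < n"
  obtains W where "W \<in> carrier_mat n n" "transpose_mat W = W" "W * W = 1\<^sub>m n"
    "W *\<^sub>v unit_vec n 0 = v"
proof (cases "v = unit_vec n 0")
  case True
  then show thesis using that[of "1\<^sub>m n"] v by simp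
next
  case False
  define u where "u = v - unit_vec n 0"
  define c where "c = 2 / (u \<bullet> u)"
  define W where "W = mat n n (\<lambda>(i,j). (if i = j then 1 else 0) - c * u $ i * u $ j)"
  have u: "u \<in> carrier_vec n" using v by (simp add: u_def)
  have "u \<noteq> 0\<^sub>v n"
  proof
    assume "u = 0\<^sub>v n"
    then have "v $ i = unit_vec n 0 $ i" if "i < n" for i
    proof -
      have "u $ i = 0" using \<open>u = 0\<^sub>v n\<close> that by simp
      then show ?thesis using that v by (simp add: u_def)
    qed
    then show False using False v by (auto intro!: eq_vecI)
  qed
  then have pos: "0 < u \<bullet> u"
    using conjugate_square_greater_0_vec[OF u] by simp
  have uu: "u \<bullet> u = 2 - 2 * v $ 0"
    using v unit n by (simp add: u_def minus_scalar_prod_distrib[of _ n] scalar_prod_minus_distrib[of _ n])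
  have cu: "c * (u \<bullet> u) = 2" using pos by (simp add: c_def)
  \<comment> \<open>the coefficient that makes the reflection move the first unit vector by exactly \<open>u\<close>\<close>
  have cu0: "c * u $ 0 = -1"
    using pos n v unfolding c_def uu by (simp add: u_def field_simps)
  have W: "W \<in> carrier_mat n n" by (simp add: W_def)
  have "transpose_mat W = W" by (rule eq_matI) (auto simp: W_def)
  moreover have "W * W = 1\<^sub>m n"
  proof (rule eq_matI)
    fix i j assume "i < dim_row (1\<^sub>m n :: real mat)" "j < dim_col (1\<^sub>m n :: real mat)"
    then have ij: "i < n" "j < n" by auto
    have "(W * W) $$ (i,j) = (\<Sum>k<n. ((if i = k then 1 else 0) - c * u $ i * u $ k) *
        ((if k = j then 1 else 0) - c * u $ k * u $ j))"
      using ij by (simp add: W_def scalar_prod_def atLeast0LessThan)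
    also have "\<dots> = (\<Sum>k<n. (if k = i then (if i = j then 1 else 0) else 0)
        - (if k = i then c * u $ i * u $ j else 0) - (if k = j then c * u $ i * u $ j else 0)
        + c * u $ i * u $ j * (c * (u $ k * u $ k)))"
      by (intro sum.cong refl) (auto simp: algebra_simps)
    also have "\<dots> = (if i = j then 1 else 0) - 2 * (c * u $ i * u $ j)
        + c * u $ i * u $ j * (c * (u \<bullet> u))"
      using ij u by (simp add: sum.distrib sum_subtractf scalar_prod_def atLeast0LessThan
          flip: sum_distrib_left)
    also have "\<dots> = (1\<^sub>m n :: real mat) $$ (i,j)" using ij by (simp add: cu)
    finally show "(W * W) $$ (i,j) = (1\<^sub>m n :: real mat) $$ (i,j)" .
  qed (auto simp: W_def)
  moreover have "W *\<^sub>v unit_vec n 0 = v"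
  proof (rule eq_vecI)
    fix i assume "i < dim_vec v"
    then have i: "i < n" using v by simp
    have "(W *\<^sub>v unit_vec n 0) $ i = (if i = 0 then 1 else 0) - u $ i * (c * u $ 0)"
      using i n by (simp add: W_def)
    also have "\<dots> = v $ i" unfolding cu0 using i v by (simp add: u_def)
    finally show "(W *\<^sub>v unit_vec n 0) $ i = v $ i" .
  qed (use v in \<open>auto simp: W_def\<close>)
  ultimately show thesis using that W by blast
qed

text \<open>Conjugating by the reflection that sends the first unit vector to a unit eigenvector clears the
first row and column outside the corner; the remaining block is symmetric of smaller size.\<close>

lemma spectral_theorem_real_symmetric:
  assumes "(A :: real mat) \<in> carrier_mat n n" and "transpose_mat A = A"
  shows "\<exists>U d. spectral_decomposition n A U d"
  using assms
proof (induction n arbitrary: A)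
  case 0
  then show ?case
    by (intro exI[of _ "1\<^sub>m 0"] exI) (auto simp: spectral_decomposition_def)
next
  case (Suc n A)
  note A = Suc.prems(1)
  obtain e v where v: "v \<in> carrier_vec (Suc n)" "v \<bullet> v = 1" "A *\<^sub>v v = e \<cdot>\<^sub>v v"
    using symmetric_has_eigenvector[OF Suc.prems] by blast
  obtain W where W: "W \<in> carrier_mat (Suc n) (Suc n)" "transpose_mat W = W"
      "W * W = 1\<^sub>m (Suc n)" "W *\<^sub>v unit_vec (Suc n) 0 = v"
    using orthogonal_mat_with_first_column[OF v(1,2)] by blast
  define B where "B = W * A * W"
  have B: "B \<in> carrier_mat (Suc n) (Suc n)" using A W by (simp add: B_def)
  have BT: "transpose_mat B = B"
    unfolding B_def using A W Suc.prems(2)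
    by (simp add: transpose_mult[of _ "Suc n" "Suc n" _ "Suc n"] assoc_mult_mat[of _ "Suc n" "Suc n" _ "Suc n" _ "Suc n"])
  have "(W * W) *\<^sub>v unit_vec (Suc n) 0 = W *\<^sub>v (W *\<^sub>v unit_vec (Suc n) 0)"
    using W(1) by (intro assoc_mult_mat_vec) auto
  then have Wv: "W *\<^sub>v v = unit_vec (Suc n) 0" using W by simp
  have "B *\<^sub>v unit_vec (Suc n) 0 = e \<cdot>\<^sub>v unit_vec (Suc n) 0"
    unfolding B_def using W A v Wv
    by (simp add: assoc_mult_mat_vec[of _ "Suc n" "Suc n" _ "Suc n"] mult_mat_vec)
  then have col0: "(B *\<^sub>v unit_vec (Suc n) 0) $ i = (e \<cdot>\<^sub>v unit_vec (Suc n) 0) $ i" for i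
    by simp
  have B0': "B $$ (i,0) = (if i = 0 then e else 0)" if "i < Suc n" for i
    using col0[of i] that B by (simp split: if_splits)
  have B_sym: "B $$ (i,j) = B $$ (j,i)" if "i < Suc n" "j < Suc n" for i j
    using that B arg_cong[OF BT, of "\<lambda>M. M $$ (i,j)"] by simp
  have B0: "B $$ (i,0) = (if i = 0 then e else 0)" "B $$ (0,i) = (if i = 0 then e else 0)"
    if "i < Suc n" for i using that B0' B_sym[of 0 i] by auto
  define A' where "A' = mat n n (\<lambda>(i,j). B $$ (Suc i, Suc j))"
  have "A' \<in> carrier_mat n n" "transpose_mat A' = A'"
    by (auto simp: A'_def B_sym)
  from Suc.IH[OF this] obtain U d where IH: "spectral_decomposition n A' U d" by blast
  note U = spectral_decompositionD[OF IH]
  \<comment> \<open>the block diagonal matrix with blocks \<open>1\<close> and \<open>U\<close>\<close>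
  define V where "V = mat (Suc n) (Suc n) (\<lambda>(i,j). case (i,j) of (0,0) \<Rightarrow> 1
     | (Suc i, Suc j) \<Rightarrow> U $$ (i,j) | _ \<Rightarrow> (0::real))"
  define d' where "d' = case_nat e d"
  have V: "V \<in> carrier_mat (Suc n) (Suc n)" by (simp add: V_def)
  have VV: "transpose_mat V * V = 1\<^sub>m (Suc n)"
  proof (rule eq_matI)
    fix i j assume "i < dim_row (1\<^sub>m (Suc n) :: real mat)" "j < dim_col (1\<^sub>m (Suc n) :: real mat)"
    then have ij: "i < Suc n" "j < Suc n" by auto
    have UU: "(\<Sum>k<n. U $$ (k,i') * U $$ (k,j')) = (if i' = j' then 1 else 0)"
      if "i' < n" "j' < n" for i' j'
      using that U(1) arg_cong[OF U(2), of "\<lambda>M. M $$ (i',j')"]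
      by (simp add: scalar_prod_def atLeast0LessThan)
    have "(transpose_mat V * V) $$ (i,j) = (\<Sum>k<Suc n. V $$ (k,i) * V $$ (k,j))"
      using ij V by (simp add: scalar_prod_def atLeast0LessThan)
    also have "\<dots> = (1\<^sub>m (Suc n) :: real mat) $$ (i,j)"
      using ij UU unfolding sum.lessThan_Suc_shift by (auto simp: V_def split: nat.splits)
    finally show "(transpose_mat V * V) $$ (i,j) = (1\<^sub>m (Suc n) :: real mat) $$ (i,j)" .
  qed (use V in auto)
  have BV: "B = V * mat_diag (Suc n) d' * transpose_mat V"
  proof (rule eq_matI)
    fix i j assume "i < dim_row (V * mat_diag (Suc n) d' * transpose_mat V)"
      "j < dim_col (V * mat_diag (Suc n) d' * transpose_mat V)"
    then have ij: "i < Suc n" "j < Suc n" using V by auto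
    have A'U: "B $$ (Suc i', Suc j') = (\<Sum>k<n. U $$ (i',k) * d k * U $$ (j',k))"
      if "i' < n" "j' < n" for i' j'
      using that U(1) arg_cong[OF U(4), of "\<lambda>M. M $$ (i',j')"]
      by (simp add: A'_def mat_diag_mult_right[of _ n n] scalar_prod_def atLeast0LessThan)
    have "(V * mat_diag (Suc n) d' * transpose_mat V) $$ (i,j)
        = (\<Sum>k<Suc n. V $$ (i,k) * d' k * V $$ (j,k))"
      using ij V by (simp add: mat_diag_mult_right[of _ "Suc n" "Suc n"] scalar_prod_def atLeast0LessThan)
    also have "\<dots> = B $$ (i,j)"
      using ij A'U B0 unfolding sum.lessThan_Suc_shift by (auto simp: V_def d'_def split: nat.splits)
    finally show "B $$ (i,j) = (V * mat_diag (Suc n) d' * transpose_mat V) $$ (i,j)" by simp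
  qed (use V B in auto)
  note assoc = assoc_mult_mat[of _ "Suc n" "Suc n" _ "Suc n" _ "Suc n"]
  define D where "D = mat_diag (Suc n) d'"
  have D: "D \<in> carrier_mat (Suc n) (Suc n)" by (simp add: D_def)
  have WW: "W * (W * M) = M" if "M \<in> carrier_mat (Suc n) (Suc n)" for M
    using that W by (simp flip: assoc)
  have tWV: "transpose_mat (W * V) = transpose_mat V * W"
    using W V by (simp add: transpose_mult)
  have "A = W * B * W"
    unfolding B_def using A W WW by (simp add: assoc)
  also have "\<dots> = (W * V) * D * transpose_mat (W * V)"
    unfolding tWV BV D_def[symmetric] using W V D by (simp add: assoc)
  finally have "A = (W * V) * D * transpose_mat (W * V)" .
  moreover have "transpose_mat (W * V) * (W * V) = 1\<^sub>m (Suc n)"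
    unfolding tWV using W V VV WW[of V] by (simp add: assoc)
  ultimately have "spectral_decomposition (Suc n) A (W * V) d'"
    unfolding spectral_decomposition_def D_def using W V by auto
  then show ?case by blast
qed

section \<open>The absolute value of a symmetric matrix\<close>

lemma orthogonal_conjugate_carrier:
  assumes "(U :: 'a :: comm_ring_1 mat) \<in> carrier_mat n n"
  shows "U * mat_diag n f * transpose_mat U \<in> carrier_mat n n"
  using assms by (intro mult_carrier_mat[of _ n n]) auto

lemma orthogonal_conjugate_mult:
  fixes U :: "'a :: comm_ring_1 mat"
  assumes U: "U \<in> carrier_mat n n" and UU: "transpose_mat U * U = 1\<^sub>m n"
  shows "(U * mat_diag n f * transpose_mat U) * (U * mat_diag n g * transpose_mat U)
       = U * mat_diag n (\<lambda>k. f k * g k) * transpose_mat U"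
proof -
  have "(U * D * transpose_mat U) * (U * E * transpose_mat U) = U * (D * E) * transpose_mat U"
    if D: "D \<in> carrier_mat n n" and E: "E \<in> carrier_mat n n" for D E
  proof -
    have "transpose_mat U * (U * M) = M" if "M \<in> carrier_mat n n" for M
      using that U UU by (simp flip: assoc_mult_mat[of _ n n _ n _ n])
    then show ?thesis
      using U D E by (simp add: assoc_mult_mat[of _ n n _ n _ n])
  qed
  from this[OF mat_diag_dim mat_diag_dim] show ?thesis by simp
qed

lemma orthogonal_conjugate_entry:
  fixes U :: "'a :: comm_ring_1 mat"
  assumes "U \<in> carrier_mat n n" and "i < n" and "j < n"
  shows "(U * mat_diag n f * transpose_mat U) $$ (i,j) = (\<Sum>k<n. U $$ (i,k) * f k * U $$ (j,k))"
  using assms by (simp add: mat_diag_mult_right[of _ n n] scalar_prod_def atLeast0LessThan)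

lemma positive_semidefinite_orthogonal_conjugate:
  assumes U: "U \<in> carrier_mat n n" and s: "\<And>k. k < n \<Longrightarrow> 0 \<le> s k"
  shows "positive_semidefinite (U * mat_diag n s * transpose_mat U)" (is "positive_semidefinite ?Q")
proof -
  have Q: "?Q \<in> carrier_mat n n" by (rule orthogonal_conjugate_carrier[OF U])
  have "transpose_mat ?Q = ?Q"
  proof (rule eq_matI)
    fix i j assume "i < dim_row ?Q" "j < dim_col ?Q"
    then show "transpose_mat ?Q $$ (i,j) = ?Q $$ (i,j)"
      using Q U by (simp add: orthogonal_conjugate_entry[OF U] mult_ac del: index_mult_mat)
  qed (use Q in auto)
  moreover have "0 \<le> x \<bullet> (?Q *\<^sub>v x)" if x: "x \<in> carrier_vec n" for x
  proof -
    have "x \<bullet> (?Q *\<^sub>v x) = (\<Sum>i<n. \<Sum>j<n. \<Sum>k<n. s k * (x $ i * U $$ (i,k)) * (x $ j * U $$ (j,k)))"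
      using x U Q by (simp add: scalar_prod_def atLeast0LessThan orthogonal_conjugate_entry[OF U]
          sum_distrib_left sum_distrib_right mult_ac del: index_mult_mat)
    also have "\<dots> = (\<Sum>i<n. \<Sum>k<n. \<Sum>j<n. s k * (x $ i * U $$ (i,k)) * (x $ j * U $$ (j,k)))"
      by (intro sum.cong refl sum.swap)
    also have "\<dots> = (\<Sum>k<n. \<Sum>i<n. \<Sum>j<n. s k * (x $ i * U $$ (i,k)) * (x $ j * U $$ (j,k)))"
      by (rule sum.swap)
    \<comment> \<open>in the coordinates \<open>U\<^sup>T x\<close> the form is a sum of squares with weights \<open>s k\<close>\<close>
    also have "\<dots> = (\<Sum>k<n. s k * (\<Sum>i<n. x $ i * U $$ (i,k))\<^sup>2)"
      unfolding power2_eq_square sum_product by (simp add: sum_distrib_left mult.assoc)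
    also have "\<dots> \<ge> 0" by (intro sum_nonneg mult_nonneg_nonneg s) auto
    finally show ?thesis .
  qed
  ultimately show ?thesis
    using Q unfolding positive_semidefinite_def by (auto simp: mat_adjoint_real)
qed

text \<open>Uniqueness of the positive semidefinite square root rests on this: such a root has no freedom on
an eigenvector of its square. The defect \<open>y = P u - s u\<close> satisfies \<open>P y = - s y\<close>, which
contradicts \<open>y \<bullet> P y \<ge> 0\<close> unless \<open>y = 0\<close> or \<open>s = 0\<close>; in the latter case \<open>P u\<close> vanishes because its squared
length is \<open>u \<bullet> P (P u) = 0\<close>.\<close>

lemma psd_root_eigenvector:
  assumes P: "P \<in> carrier_mat n n" and psd: "positive_semidefinite P"
    and u: "u \<in> carrier_vec n" and s: "0 \<le> s" and PPu: "P *\<^sub>v (P *\<^sub>v u) = s\<^sup>2 \<cdot>\<^sub>v u"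
  shows "P *\<^sub>v u = s \<cdot>\<^sub>v u"
proof -
  define y where "y = P *\<^sub>v u - s \<cdot>\<^sub>v u"
  have Pu: "P *\<^sub>v u \<in> carrier_vec n" by (rule mult_mat_vec_carrier[OF P u])
  have y: "y \<in> carrier_vec n" using u P by (simp add: y_def)
  have Py: "P *\<^sub>v y = - s \<cdot>\<^sub>v y"
  proof -
    have "P *\<^sub>v y = s\<^sup>2 \<cdot>\<^sub>v u - s \<cdot>\<^sub>v (P *\<^sub>v u)"
      using P u Pu by (simp add: y_def mult_minus_distrib_mat_vec mult_mat_vec PPu)
    also have "\<dots> = - s \<cdot>\<^sub>v y"
      using P u Pu by (auto intro!: eq_vecI simp: y_def algebra_simps power2_eq_square)
    finally show ?thesis .
  qed
  have sym: "transpose_mat P = P"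
    using psd by (simp add: positive_semidefinite_def mat_adjoint_real)
  have yy: "0 \<le> y \<bullet> y" using conjugate_square_ge_0_vec[of y] by simp
  have "y \<bullet> y = 0"
  proof (cases "s = 0")
    case True
    then have yP: "y = P *\<^sub>v u" using u P by (auto intro!: eq_vecI simp: y_def)
    have "y \<bullet> y = u \<bullet> (P *\<^sub>v (P *\<^sub>v u))"
      unfolding yP using transpose_vec_mult_scalar[OF P Pu u] sym
      by (metis P Pu comm_scalar_prod u)
    also have "\<dots> = 0" unfolding PPu using True u by simp
    finally show ?thesis .
  next
    case False
    have "0 \<le> y \<bullet> (P *\<^sub>v y)"
      using psd P y unfolding positive_semidefinite_def by auto
    then have "s * (y \<bullet> y) \<le> 0" unfolding Py using y by simp
    then show ?thesis using s False yy
      by (metis antisym_conv1 linorder_not_less mult_pos_pos order_less_le)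
  qed
  then have "y = 0\<^sub>v n" using conjugate_square_eq_0_vec[OF y] by simp
  then have "(P *\<^sub>v u - s \<cdot>\<^sub>v u) $ i = 0" if "i < n" for i using that by (simp add: y_def)
  then show ?thesis using P u by (auto intro!: eq_vecI)
qed

lemma psd_sqrt_eq:
  assumes "spectral_decomposition n B U (\<lambda>k. (s k)\<^sup>2)" and s: "\<And>k. k < n \<Longrightarrow> 0 \<le> s k"
  shows "psd_sqrt B = U * mat_diag n s * transpose_mat U"
  unfolding psd_sqrt_def
proof (rule the_equality)
  note U = spectral_decompositionD[OF assms(1)]
  show "positive_semidefinite (U * mat_diag n s * transpose_mat U) \<and>
      (U * mat_diag n s * transpose_mat U) * (U * mat_diag n s * transpose_mat U) = B"
    using positive_semidefinite_orthogonal_conjugate[OF U(1) s] U(4)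
    by (simp add: orthogonal_conjugate_mult[OF U(1,2)] power2_eq_square)
  fix P assume asm: "positive_semidefinite P \<and> P * P = B"
  then have psd: "positive_semidefinite P" and PP: "P * P = B" by auto
  have "dim_row P = n" using PP U(5) by (metis carrier_matD(1) index_mult_mat(2))
  then have P: "P \<in> carrier_mat n n"
    using psd unfolding positive_semidefinite_def by auto
  have BU: "B * U = U * mat_diag n (\<lambda>k. (s k)\<^sup>2)"
    unfolding U(4) using U(1,2)
    by (simp add: assoc_mult_mat[of "U * mat_diag n (\<lambda>k. (s k)\<^sup>2)" n n "transpose_mat U" n U n]
        mult_carrier_mat[OF U(1) mat_diag_dim] right_mult_one_mat[OF mult_carrier_mat[OF U(1) mat_diag_dim]])
  \<comment> \<open>any other root agrees with the candidate on the eigenbasis formed by the columns of \<open>U\<close>\<close>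
  have "P * U = U * mat_diag n s"
  proof (rule mat_col_eqI)
    fix k assume "k < dim_col (U * mat_diag n s)"
    then have k: "k < n" by (simp add: mat_diag_def)
    have diag_col: "col (U * mat_diag n f) k = f k \<cdot>\<^sub>v col U k" for f
      using k U(1) by (auto intro!: eq_vecI simp: mat_diag_mult_right[OF U(1)])
    have u: "col U k \<in> carrier_vec n" using U(1) k by simp
    have "P *\<^sub>v (P *\<^sub>v col U k) = B *\<^sub>v col U k"
      unfolding PP[symmetric] by (rule assoc_mult_mat_vec[OF P P u, symmetric])
    also have "\<dots> = col (B * U) k" by (rule col_mult2[OF U(5,1) k, symmetric])
    also have "\<dots> = (s k)\<^sup>2 \<cdot>\<^sub>v col U k" unfolding BU by (rule diag_col)
    finally have "P *\<^sub>v col U k = s k \<cdot>\<^sub>v col U k"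
      by (rule psd_root_eigenvector[OF P psd u s[OF k]])
    then show "col (P * U) k = col (U * mat_diag n s) k"
      unfolding diag_col by (simp only: col_mult2[OF P U(1) k])
  qed (use P U(1) in \<open>auto simp: mat_diag_def\<close>)
  then have "P * U * transpose_mat U = U * mat_diag n s * transpose_mat U" by simp
  then show "P = U * mat_diag n s * transpose_mat U"
    using P U(1,3) by (simp add: assoc_mult_mat[of P n n U n "transpose_mat U" n])
qed

text \<open>The energy of a vertex is thus the mean of \<open>\<bar>d k\<bar>\<close> over the spectrum, with respect to the
spectral measure \<open>(U\<^sub>i\<^sub>k)\<^sup>2\<close> of that vertex.\<close>

lemma abs_mat_diagonal_entry:
  assumes dec: "spectral_decomposition n A U d" and i: "i < n"
  shows "abs_mat A $$ (i,i) = (\<Sum>k<n. (U $$ (i,k))\<^sup>2 * \<bar>d k\<bar>)"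
proof -
  note U = spectral_decompositionD[OF dec]
  have "transpose_mat A = A"
  proof (rule eq_matI)
    fix i j assume "i < dim_row A" "j < dim_col A"
    then show "transpose_mat A $$ (i,j) = A $$ (i,j)"
      using U(5) unfolding U(4)
      by (simp add: orthogonal_conjugate_entry[OF U(1)] mult_ac del: index_mult_mat)
  qed (use U(5) in auto)
  then have "A * mat_adjoint A = U * mat_diag n (\<lambda>k. \<bar>d k\<bar>\<^sup>2) * transpose_mat U"
    using orthogonal_conjugate_mult[OF U(1,2), of d d] U(4)
    by (simp add: mat_adjoint_real power2_eq_square)
  then have "spectral_decomposition n (A * mat_adjoint A) U (\<lambda>k. \<bar>d k\<bar>\<^sup>2)"
    using U(1,2) by (simp add: spectral_decomposition_def)
  then have "abs_mat A = U * mat_diag n (\<lambda>k. \<bar>d k\<bar>) * transpose_mat U"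
    unfolding abs_mat_def by (rule psd_sqrt_eq) simp
  then show ?thesis
    using i by (simp add: orthogonal_conjugate_entry[OF U(1)] power2_eq_square mult_ac del: index_mult_mat)
qed

lemma spectral_weights_sum:
  assumes dec: "spectral_decomposition n A U d" and i: "i < n"
  shows "(\<Sum>k<n. (U $$ (i,k))\<^sup>2) = 1"
proof -
  note U = spectral_decompositionD[OF dec]
  have "(U * transpose_mat U) $$ (i,i) = 1" unfolding U(3) using i by simp
  then show ?thesis using U(1) i by (simp add: scalar_prod_def atLeast0LessThan power2_eq_square)
qed

section \<open>The resolvent and deletion of a row and column\<close>

text \<open>The diagonal entry of the resolvent \<open>(z - A)\<^sup>-\<^sup>1\<close>, computed in two ways: by Cramer's rule it is a
quotient of characteristic polynomials, and by diagonalisation it is the Stieltjes transform of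
the spectral measure. This is the only link between the deleted matrix and the eigenvectors.\<close>

lemma char_poly_ratio:
  fixes z :: complex
  assumes dec: "spectral_decomposition n A U d" and i: "i < n"
    and z: "\<And>k. k < n \<Longrightarrow> z \<noteq> of_real (d k)"
  shows "poly (map_poly of_real (char_poly A)) z \<noteq> 0"
    and "poly (map_poly of_real (char_poly (mat_delete A i i))) z
       = poly (map_poly of_real (char_poly A)) z * (\<Sum>k<n. of_real ((U $$ (i,k))\<^sup>2) / (z - of_real (d k)))"
proof -
  note U = spectral_decompositionD[OF dec]
  define C where "C = map_mat complex_of_real A"
  define V where "V = map_mat complex_of_real U"
  have C: "C \<in> carrier_mat n n" and V: "V \<in> carrier_mat n n" using U by (auto simp: C_def V_def)
  have VV: "V * transpose_mat V = 1\<^sub>m n" "transpose_mat V * V = 1\<^sub>m n"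
    using U(1) of_real_hom.mat_hom_mult[of U n n "transpose_mat U" n, where ?'a = complex]
      of_real_hom.mat_hom_mult[of "transpose_mat U" n n U n, where ?'a = complex]
    by (simp_all add: V_def U(2,3) map_mat_transpose of_real_hom.mat_hom_one)
  define M where "M = - char_matrix C z"
  define R where "R = V * mat_diag n (\<lambda>k. 1 / (z - of_real (d k))) * transpose_mat V"
  have M: "M \<in> carrier_mat n n" and R: "R \<in> carrier_mat n n" using C V by (auto simp: M_def R_def)
  have "M = V * mat_diag n (\<lambda>k. z - of_real (d k)) * transpose_mat V"
  proof (rule eq_matI)
    fix a b assume "a < dim_row (V * mat_diag n (\<lambda>k. z - of_real (d k)) * transpose_mat V)"
      "b < dim_col (V * mat_diag n (\<lambda>k. z - of_real (d k)) * transpose_mat V)"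
    then have ab: "a < n" "b < n" using V by auto
    have "(V * transpose_mat V) $$ (a,b) = (if a = b then 1 else 0)" unfolding VV using ab by simp
    then have one: "(if a = b then 1 else 0) = (\<Sum>k<n. V $$ (a,k) * V $$ (b,k))"
      using V ab by (simp add: scalar_prod_def atLeast0LessThan)
    have A: "A $$ (a,b) = (\<Sum>k<n. U $$ (a,k) * d k * U $$ (b,k))"
      unfolding U(4) by (rule orthogonal_conjugate_entry[OF U(1) ab])
    have "C $$ (a,b) = (\<Sum>k<n. V $$ (a,k) * of_real (d k) * V $$ (b,k))"
      using ab U(1,5) by (simp add: C_def V_def A)
    then have "M $$ (a,b) = z * (\<Sum>k<n. V $$ (a,k) * V $$ (b,k))
        - (\<Sum>k<n. V $$ (a,k) * of_real (d k) * V $$ (b,k))"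
      using ab C one[symmetric] by (simp add: M_def char_matrix_def)
    also have "\<dots> = (\<Sum>k<n. V $$ (a,k) * (z - of_real (d k)) * V $$ (b,k))"
      by (simp add: sum_distrib_left algebra_simps flip: sum_subtractf)
    finally show "M $$ (a,b) = (V * mat_diag n (\<lambda>k. z - of_real (d k)) * transpose_mat V) $$ (a,b)"
      by (simp only: orthogonal_conjugate_entry[OF V ab])
  qed (use M V in auto)
  then have "M * R = V * mat_diag n (\<lambda>k. (z - of_real (d k)) * (1 / (z - of_real (d k)))) * transpose_mat V"
    unfolding R_def by (simp only: orthogonal_conjugate_mult[OF V VV(2)])
  also have "mat_diag n (\<lambda>k. (z - of_real (d k)) * (1 / (z - of_real (d k)))) = 1\<^sub>m n"
    using z by (auto intro!: eq_matI simp: mat_diag_def)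
  also have "V * 1\<^sub>m n * transpose_mat V = 1\<^sub>m n" using V VV by simp
  finally have MR: "M * R = 1\<^sub>m n" .
  have det_M: "det M = poly (map_poly of_real (char_poly A)) z"
    using char_poly_matrix[OF C, of z] of_real_hom.char_poly_hom[OF U(5), where ?'a = complex]
    by (simp add: M_def C_def)
  have "det M * det R = 1" using det_mult[OF M R] MR by simp
  then show "poly (map_poly of_real (char_poly A)) z \<noteq> 0" by (auto simp flip: det_M)
  \<comment> \<open>Cramer's rule: the adjugate is the determinant times the inverse \<open>R\<close>\<close>
  have "adj_mat M = adj_mat M * (M * R)" using adj_mat(1)[OF M] MR by simp
  also have "\<dots> = (det M \<cdot>\<^sub>m 1\<^sub>m n) * R"
    using adj_mat[OF M] M R by (simp flip: assoc_mult_mat[of _ n n _ n _ n])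
  finally have "adj_mat M $$ (i,i) = det M * R $$ (i,i)" using R i by simp
  moreover have "adj_mat M $$ (i,i) = det (mat_delete M i i)"
    using M i by (simp add: adj_mat_def cofactor_def flip: mult_2)
  moreover have "mat_delete M i i = - char_matrix (mat_delete C i i) z"
    using C i by (intro eq_matI) (auto simp: M_def mat_delete_def char_matrix_def)
  moreover have "det (- char_matrix (mat_delete C i i) z)
      = poly (map_poly of_real (char_poly (mat_delete A i i))) z"
  proof -
    have "mat_delete C i i = map_mat of_real (mat_delete A i i)"
      using U(5) i by (intro eq_matI) (auto simp: C_def mat_delete_def)
    then show ?thesis
      using char_poly_matrix[OF mat_delete_carrier[OF C], of i i z]
        of_real_hom.char_poly_hom[OF mat_delete_carrier[OF U(5)], of i i, where ?'a = complex]
      by simp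
  qed
  moreover have "R $$ (i,i) = (\<Sum>k<n. of_real ((U $$ (i,k))\<^sup>2) / (z - of_real (d k)))"
    unfolding R_def orthogonal_conjugate_entry[OF V i i]
    using U(1) i by (intro sum.cong refl) (simp add: V_def power2_eq_square)
  ultimately show "poly (map_poly of_real (char_poly (mat_delete A i i))) z
       = poly (map_poly of_real (char_poly A)) z * (\<Sum>k<n. of_real ((U $$ (i,k))\<^sup>2) / (z - of_real (d k)))"
    by (simp add: det_M)
qed

section \<open>Polynomials of one parity on the imaginary axis\<close>

text \<open>Characteristic polynomials of bipartite graphs of order \<open>n\<close> contain only the powers
\<open>x\<^sup>n, x\<^sup>n\<^sup>-\<^sup>2, \<dots>\<close>. The evenness of \<open>n + j\<close> expresses this without truncated subtraction.\<close>

definition single_parity :: "nat \<Rightarrow> real poly \<Rightarrow> bool" where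
  "single_parity n p \<longleftrightarrow> degree p \<le> n \<and> (\<forall>j. coeff p j \<noteq> 0 \<longrightarrow> even (n + j))"

lemma single_parity_mult:
  assumes "single_parity m p" "single_parity n q"
  shows "single_parity (m + n) (p * q)"
  unfolding single_parity_def
proof (intro conjI allI impI)
  show "degree (p * q) \<le> m + n"
    using assms degree_mult_le[of p q] unfolding single_parity_def by linarith
  fix j assume "coeff (p * q) j \<noteq> 0"
  then obtain i where "i \<le> j" "coeff p i * coeff q (j - i) \<noteq> 0"
    unfolding coeff_mult by (metis (no_types, lifting) atMost_iff sum.not_neutral_contains_not_neutral)
  then have "even (m + i)" "even (n + (j - i))" "i \<le> j"
    using assms unfolding single_parity_def by auto
  then show "even (m + n + j)" by (metis even_add le_add_diff_inverse)
qed

lemma single_parityI: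
  assumes deg: "degree p \<le> n" and sym: "\<And>x. poly p (- x) = (-1) ^ n * poly p x"
  shows "single_parity n (p :: real poly)"
  unfolding single_parity_def
proof (intro conjI allI impI deg)
  fix j assume nz: "coeff p j \<noteq> 0"
  have "p \<circ>\<^sub>p [:0, -1:] = Polynomial.smult ((-1) ^ n) p"
    unfolding poly_eq_poly_eq_iff[symmetric] by (rule ext) (simp add: poly_pcompose sym)
  then have "(-1) ^ j * coeff p j = (-1) ^ n * coeff p j"
    by (metis coeff_pcompose_linear coeff_smult)
  then have "(-1 :: real) ^ (n + j) = 1"
    using nz by (simp add: power_add flip: power_mult_distrib)
  then show "even (n + j)" by (metis minus_one_power_iff one_neq_neg_one)
qed

text \<open>For a polynomial of the parity of \<open>n\<close> this is \<open>p(\<i> x) / \<i>\<^sup>n\<close>, which is again real. For a bipartite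
graph its coefficients are exactly the numbers \<open>b\<^bsub>2k\<^esub>\<close>, so the quasi-order compares rotated
characteristic polynomials coefficientwise. Truncation in the exponent is harmless: it
affects only coefficients of the wrong parity, which vanish.\<close>

definition rotate_poly :: "nat \<Rightarrow> real poly \<Rightarrow> real poly" where
  "rotate_poly n p = (\<Sum>j\<le>n. monom ((-1) ^ ((n - j) div 2) * coeff p j) j)"

lemma coeff_rotate_poly:
  "coeff (rotate_poly n p) j = (if j \<le> n then (-1) ^ ((n - j) div 2) * coeff p j else 0)"
  unfolding rotate_poly_def coeff_sum by simp

lemma poly_rotate_poly:
  assumes "single_parity n p"
  shows "poly (map_poly of_real p) (\<i> * of_real x) = \<i> ^ n * of_real (poly (rotate_poly n p) x)"
proof -
  have "degree (map_poly complex_of_real p) \<le> n"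
    using assms by (simp add: single_parity_def)
  then have "map_poly complex_of_real p = (\<Sum>j\<le>n. monom (of_real (coeff p j)) j)"
    using poly_as_sum_of_monoms'[of "map_poly complex_of_real p" n] by (simp add: coeff_map_poly)
  then have "poly (map_poly of_real p) (\<i> * of_real x)
      = (\<Sum>j\<le>n. of_real (coeff p j) * (\<i> * of_real x) ^ j)"
    by (simp add: poly_sum poly_monom)
  also have "\<dots> = (\<Sum>j\<le>n. \<i> ^ n * of_real ((-1) ^ ((n - j) div 2) * coeff p j * x ^ j))"
  proof (intro sum.cong refl)
    fix j assume "j \<in> {..n}"
    then have j: "j \<le> n" by simp
    show "of_real (coeff p j) * (\<i> * of_real x) ^ j
        = \<i> ^ n * of_real ((-1) ^ ((n - j) div 2) * coeff p j * x ^ j)"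
    proof (cases "coeff p j = 0")
      case False
      then have "even (n + j)" using assms by (simp add: single_parity_def)
      then have "even (n - j)" using j by (simp add: even_diff_nat)
      then obtain k where k: "n = j + 2 * k" using j by (metis evenE le_add_diff_inverse)
      have "\<i> ^ n * (-1) ^ k = \<i> ^ j"
        unfolding k by (simp add: power_add power_mult flip: power_mult_distrib)
      then show ?thesis using k by (simp add: power_mult_distrib mult_ac)
    qed simp
  qed
  also have "\<dots> = \<i> ^ n * of_real (poly (rotate_poly n p) x)"
    by (simp add: rotate_poly_def poly_sum poly_monom sum_distrib_left)
  finally show ?thesis .
qed

lemma poly_rotate_poly_mult:
  assumes "single_parity m p" "single_parity n q"
  shows "poly (rotate_poly (m + n) (p * q)) x = poly (rotate_poly m p) x * poly (rotate_poly n q) x"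
proof -
  interpret of_real_poly: map_poly_comm_ring_hom complex_of_real ..
  have "\<i> ^ (m + n) * complex_of_real (poly (rotate_poly (m + n) (p * q)) x)
      = poly (map_poly of_real (p * q)) (\<i> * of_real x)"
    by (rule poly_rotate_poly[OF single_parity_mult[OF assms], symmetric])
  also have "\<dots> = (\<i> ^ m * of_real (poly (rotate_poly m p) x)) * (\<i> ^ n * of_real (poly (rotate_poly n q) x))"
    by (simp add: of_real_poly.hom_mult poly_rotate_poly[OF assms(1)] poly_rotate_poly[OF assms(2)])
  also have "\<dots> = \<i> ^ (m + n) * of_real (poly (rotate_poly m p) x * poly (rotate_poly n q) x)"
    by (simp add: power_add mult_ac)
  finally show ?thesis by (simp only: mult_cancel_left power_not_zero of_real_eq_iff) simp
qed

lemma poly_mono_coeffs: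
  fixes p q :: "real poly"
  assumes "\<And>j. coeff p j \<le> coeff q j" and "0 \<le> x"
  shows "poly p x \<le> poly q x"
proof -
  have "0 \<le> poly (q - p) x"
    unfolding poly_altdef using assms by (intro sum_nonneg mult_nonneg_nonneg) auto
  then show ?thesis by simp
qed

text \<open>Fixes the sign of the rotated characteristic polynomials, so that one may divide by them in
an inequality: a sign change would force a root by the intermediate value theorem.\<close>

lemma monic_poly_pos_beyond_roots:
  fixes q :: "real poly"
  assumes lc: "lead_coeff q > 0" and nz: "\<And>y. x \<le> y \<Longrightarrow> poly q y \<noteq> 0"
  shows "0 < poly q x"
proof (rule ccontr)
  assume "\<not> 0 < poly q x"
  then have neg: "poly q x < 0" using nz[of x] by simp
  obtain n where n: "\<forall>y\<ge>n. poly q y \<ge> lead_coeff q" using poly_pinfty_gt_lc[OF lc] by blast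
  define y where "y = max n (x + 1)"
  have "0 < poly q y" using n lc unfolding y_def by (meson max.cobounded1 order_less_le_trans)
  moreover have "x < y" by (simp add: y_def)
  ultimately obtain t where "x < t" "poly q t = 0"
    using poly_IVT_pos[of x y q] neg by auto
  then show False using nz[of t] by simp
qed

text \<open>The resolvent identity at \<open>z = \<i> x\<close>. Real eigenvalues never meet the positive imaginary axis,
whence the rotated characteristic polynomial has no positive root. The powers of \<open>\<i>\<close> combine to
\<open>\<i> / (\<i> x - d) = (x - \<i> d) / (x\<^sup>2 + d\<^sup>2)\<close>, and only real parts survive since the left hand side
is real.\<close>

lemma rotated_char_poly_ratio:
  assumes dec: "spectral_decomposition n A U d" and i: "i < n"
    and par: "single_parity n (char_poly A)"
      "single_parity (n - 1) (char_poly (mat_delete A i i))"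
    and x: "0 < x"
  shows "0 < poly (rotate_poly n (char_poly A)) x"
    and "poly (rotate_poly (n - 1) (char_poly (mat_delete A i i))) x
       = poly (rotate_poly n (char_poly A)) x * (\<Sum>k<n. (U $$ (i,k))\<^sup>2 * x / (x\<^sup>2 + (d k)\<^sup>2))"
proof -
  let ?q = "rotate_poly n (char_poly A)"
  note A = spectral_decompositionD(5)[OF dec]
  have off: "\<i> * of_real y \<noteq> of_real r" if "0 < y" for y r
    using that by (simp add: complex_eq_iff)
  have nz: "poly ?q y \<noteq> 0" if "0 < y" for y
    using char_poly_ratio(1)[OF dec i off[OF that]] poly_rotate_poly[OF par(1), of y] by auto
  have lead: "coeff ?q n = 1"
    using degree_monic_char_poly[OF A] by (simp add: coeff_rotate_poly)
  have "degree ?q \<le> n" by (rule degree_le) (simp add: coeff_rotate_poly)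
  then have "lead_coeff ?q = 1" using lead le_degree[of ?q n] by (simp add: order_antisym)
  then show pos: "0 < poly ?q x"
    using x nz by (intro monic_poly_pos_beyond_roots) auto
  have summand: "\<i> * (of_real (p :: real) / (\<i> * of_real x - of_real r))
      = of_real (p * x / (x\<^sup>2 + r\<^sup>2)) - \<i> * of_real (p * r / (x\<^sup>2 + r\<^sup>2))" for p r
    using x by (simp add: complex_eq_iff Re_divide Im_divide power2_eq_square add.commute)
  define S where "S = (\<Sum>k<n. of_real ((U $$ (i,k))\<^sup>2) / (\<i> * of_real x - of_real (d k)))"
  have "\<i> ^ (n - 1) * complex_of_real (poly (rotate_poly (n - 1) (char_poly (mat_delete A i i))) x)
      = \<i> ^ n * of_real (poly ?q x) * S"
    unfolding S_def using char_poly_ratio(2)[OF dec i off[OF x]]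
      poly_rotate_poly[OF par(1), of x] poly_rotate_poly[OF par(2), of x] by simp
  also have "\<i> ^ n = \<i> ^ (n - 1) * \<i>" using i by (metis gr_implies_not0 power_minus_mult not_gr_zero)
  finally have "complex_of_real (poly (rotate_poly (n - 1) (char_poly (mat_delete A i i))) x)
      = of_real (poly ?q x) * (\<i> * S)" by simp
  then have "poly (rotate_poly (n - 1) (char_poly (mat_delete A i i))) x
      = Re (of_real (poly ?q x) * (\<i> * S))" by (metis Re_complex_of_real)
  also have "\<dots> = poly ?q x * Re (\<i> * S)" by simp
  also have "Re (\<i> * S) = (\<Sum>k<n. (U $$ (i,k))\<^sup>2 * x / (x\<^sup>2 + (d k)\<^sup>2))"
    unfolding S_def sum_distrib_left summand Re_sum by simp
  finally show "poly (rotate_poly (n - 1) (char_poly (mat_delete A i i))) x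
       = poly ?q x * (\<Sum>k<n. (U $$ (i,k))\<^sup>2 * x / (x\<^sup>2 + (d k)\<^sup>2))" .
qed

section \<open>From Lorentzian sums to sums of absolute values\<close>

text \<open>For \<open>a = 0\<close> both the function and the fraction vanish, the latter even at \<open>x = 0\<close> because
\<open>0 / 0 = 0\<close>.\<close>

lemma arctan_primitive:
  "((\<lambda>x. \<bar>a\<bar> * arctan (x / \<bar>a\<bar>)) has_real_derivative a\<^sup>2 / (x\<^sup>2 + a\<^sup>2)) (at x)"
proof (cases "a = 0")
  case False
  have "1 + (x / \<bar>a\<bar>)\<^sup>2 = (x\<^sup>2 + a\<^sup>2) / a\<^sup>2"
    using False by (simp add: power_divide add_divide_distrib)
  then have "inverse (1 + (x / \<bar>a\<bar>)\<^sup>2) = a\<^sup>2 / (x\<^sup>2 + a\<^sup>2)"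
    by simp
  then have "\<bar>a\<bar> * (inverse (1 + (x / \<bar>a\<bar>)\<^sup>2) * (1 / \<bar>a\<bar>)) = a\<^sup>2 / (x\<^sup>2 + a\<^sup>2)"
    using False by simp
  moreover have "((\<lambda>x. \<bar>a\<bar> * arctan (x / \<bar>a\<bar>)) has_real_derivative
      \<bar>a\<bar> * (inverse (1 + (x / \<bar>a\<bar>)\<^sup>2) * (1 / \<bar>a\<bar>))) (at x)"
    by (intro DERIV_cmult DERIV_chain'[OF DERIV_cdivide[OF DERIV_ident] DERIV_arctan])
  ultimately show ?thesis by simp
qed auto

lemma arctan_primitive_at_top:
  "((\<lambda>x. \<bar>a\<bar> * arctan (x / \<bar>a\<bar>)) \<longlongrightarrow> \<bar>a\<bar> * (pi / 2)) at_top"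
proof (cases "a = 0")
  case False
  then have "filterlim (\<lambda>x. x * (1 / \<bar>a\<bar>)) at_top at_top"
    by (intro filterlim_at_top_mult_tendsto_pos[where c = "1 / \<bar>a\<bar>"] tendsto_const filterlim_ident) auto
  then show ?thesis
    by (intro tendsto_mult tendsto_const filterlim_compose[OF tendsto_arctan_at_top]) simp
qed auto

text \<open>The integral of \<open>a\<^sup>2 / (x\<^sup>2 + a\<^sup>2)\<close> over \<open>x > 0\<close> is \<open>\<bar>a\<bar> \<pi> / 2\<close>, so integrating the hypothesis gives the
claim. With the explicit primitive \<open>\<bar>a\<bar> arctan (x / \<bar>a\<bar>)\<close> no integral is needed: the difference
\<open>F\<close> of the primitives vanishes at \<open>0\<close>, increases, and tends to the difference of the two sums
times \<open>\<pi> / 2\<close>.\<close>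

lemma sum_abs_le_of_sum_lorentzian_le:
  fixes p a :: "'i \<Rightarrow> real" and q b :: "'j \<Rightarrow> real"
  assumes le: "\<And>x. 0 < x \<Longrightarrow> (\<Sum>k\<in>I. p k * ((a k)\<^sup>2 / (x\<^sup>2 + (a k)\<^sup>2))) \<le> (\<Sum>k\<in>J. q k * ((b k)\<^sup>2 / (x\<^sup>2 + (b k)\<^sup>2)))"
  shows "(\<Sum>k\<in>I. p k * \<bar>a k\<bar>) \<le> (\<Sum>k\<in>J. q k * \<bar>b k\<bar>)"
proof -
  define F where "F x = (\<Sum>k\<in>J. q k * (\<bar>b k\<bar> * arctan (x / \<bar>b k\<bar>)))
      - (\<Sum>k\<in>I. p k * (\<bar>a k\<bar> * arctan (x / \<bar>a k\<bar>)))" for x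
  have deriv: "(F has_real_derivative (\<Sum>k\<in>J. q k * ((b k)\<^sup>2 / (x\<^sup>2 + (b k)\<^sup>2)))
      - (\<Sum>k\<in>I. p k * ((a k)\<^sup>2 / (x\<^sup>2 + (a k)\<^sup>2)))) (at x)" for x
    unfolding F_def by (intro DERIV_diff DERIV_sum DERIV_cmult arctan_primitive)
  have "0 \<le> F x" if "0 < x" for x
  proof -
    have "F 0 \<le> F x"
    proof (rule DERIV_nonneg_imp_increasing_open[of 0 x F])
      show "0 \<le> x" using that by simp
      show "continuous_on {0..x} F"
        using deriv by (meson DERIV_isCont continuous_at_imp_continuous_on)
      fix y assume "0 < y" "y < x"
      then show "\<exists>D. (F has_real_derivative D) (at y) \<and> 0 \<le> D" using deriv[of y] le[of y] by force
    qed
    then show ?thesis by (simp add: F_def)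
  qed
  then have "\<forall>\<^sub>F x in at_top. 0 \<le> F x" by (metis eventually_at_top_dense)
  moreover have "(F \<longlongrightarrow> (\<Sum>k\<in>J. q k * (\<bar>b k\<bar> * (pi / 2))) - (\<Sum>k\<in>I. p k * (\<bar>a k\<bar> * (pi / 2)))) at_top"
    unfolding F_def by (intro tendsto_diff tendsto_sum tendsto_mult_left arctan_primitive_at_top)
  ultimately have "0 \<le> (\<Sum>k\<in>J. q k * (\<bar>b k\<bar> * (pi / 2))) - (\<Sum>k\<in>I. p k * (\<bar>a k\<bar> * (pi / 2)))"
    by (intro tendsto_lowerbound) auto
  also have "\<dots> = ((\<Sum>k\<in>J. q k * \<bar>b k\<bar>) - (\<Sum>k\<in>I. p k * \<bar>a k\<bar>)) * (pi / 2)"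
    by (simp only: left_diff_distrib sum_distrib_right mult.assoc)
  finally show ?thesis using pi_gt_zero by (simp add: zero_le_mult_iff)
qed

section \<open>Adjacency matrices and their characteristic polynomials\<close>

text \<open>Adjacency matrices with respect to an explicit numbering of vertices, which frees the arguments
from the arbitrary one chosen in \<^const>\<open>vertex_list\<close>. Arcs with an endpoint outside the list are
ignored, so a vertex is deleted by dropping it from the list.\<close>

definition adjacency_along :: "('a \<times> 'a) set \<Rightarrow> 'a list \<Rightarrow> real mat" where
  "adjacency_along E vs =
     mat (length vs) (length vs) (\<lambda>(i,j). if (vs ! i, vs ! j) \<in> E then 1 else 0)"

lemma adjacency_along_carrier: "adjacency_along E vs \<in> carrier_mat (length vs) (length vs)"
  by (simp add: adjacency_along_def)

lemma adjacency_along_cong: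
  assumes "\<And>x y. x \<in> set vs \<Longrightarrow> y \<in> set vs \<Longrightarrow> (x,y) \<in> E \<longleftrightarrow> (x,y) \<in> F"
  shows "adjacency_along E vs = adjacency_along F vs"
  unfolding adjacency_along_def using assms by (intro cong_mat) auto

text \<open>Two numberings differ by a permutation matrix \<open>P\<close>, which conjugates one adjacency matrix to the
other.\<close>

lemma char_poly_adjacency_along_reorder:
  assumes us: "distinct us" and vs: "distinct vs" and same: "set us = set vs"
  shows "char_poly (adjacency_along E us) = char_poly (adjacency_along E vs)"
proof -
  define n where "n = length vs"
  have len: "length us = n" using us vs same by (metis distinct_card n_def)
  have "\<exists>k. k < n \<and> vs ! k = us ! i" if "i < n" for i
    using that len same unfolding n_def by (metis in_set_conv_nth)
  then obtain p where p: "\<And>i. i < n \<Longrightarrow> p i < n \<and> vs ! (p i) = us ! i" by metis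
  have p_eq: "p i = p j \<longleftrightarrow> i = j" if "i < n" "j < n" for i j
    using p that us len by (metis nth_eq_iff_index_eq)
  define P where "P = mat n n (\<lambda>(i,k). if k = p i then 1 else (0::real))"
  define A where "A = adjacency_along E vs"
  have P: "P \<in> carrier_mat n n" and A: "A \<in> carrier_mat n n"
    by (auto simp: P_def A_def n_def adjacency_along_def)
  have PM: "(P * M) $$ (i,j) = M $$ (p i, j)" if "M \<in> carrier_mat n n" "i < n" "j < n" for M i j
    using that p[of i] by (simp add: P_def scalar_prod_def if_distrib[of "\<lambda>x. x * _"] cong: if_cong)
  have MP: "(M * transpose_mat P) $$ (i,j) = M $$ (i, p j)" if "M \<in> carrier_mat n n" "i < n" "j < n" for M i j
    using that p[of j] by (simp add: P_def scalar_prod_def if_distrib[of "\<lambda>x. _ * x"] cong: if_cong)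
  have PPT: "P * transpose_mat P = 1\<^sub>m n"
  proof (rule eq_matI)
    fix i j assume "i < dim_row (1\<^sub>m n :: real mat)" "j < dim_col (1\<^sub>m n :: real mat)"
    then have ij: "i < n" "j < n" by auto
    show "(P * transpose_mat P) $$ (i,j) = (1\<^sub>m n :: real mat) $$ (i,j)"
      using MP[OF P ij] ij p[of j] p_eq[of j i] by (simp add: P_def eq_commute[of i j])
  qed (use P in auto)
  moreover have "transpose_mat P * P = 1\<^sub>m n"
    using mat_mult_left_right_inverse[OF P _ PPT] P by simp
  moreover have "adjacency_along E us = P * A * transpose_mat P"
  proof (rule eq_matI)
    fix i j assume "i < dim_row (P * A * transpose_mat P)" "j < dim_col (P * A * transpose_mat P)"
    then have ij: "i < n" "j < n" using P by auto
    have "(P * A * transpose_mat P) $$ (i,j) = A $$ (p i, p j)"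
      using MP[of "P * A" i j] PM[OF A, of i "p j"] P A ij p[of j] by simp
    then show "adjacency_along E us $$ (i,j) = (P * A * transpose_mat P) $$ (i,j)"
      using ij p[of i] p[of j] len by (simp add: A_def adjacency_along_def n_def)
  qed (use P len in \<open>auto simp: adjacency_along_def\<close>)
  ultimately have "similar_mat (adjacency_along E us) A"
    unfolding similar_mat_def
    using similar_mat_witI[of P "transpose_mat P" n "adjacency_along E us" A] P A len
    by (metis adjacency_along_carrier transpose_carrier_mat)
  then show ?thesis unfolding A_def by (rule char_poly_similar)
qed

lemma char_poly_block_diagonal:
  fixes A B :: "'a :: idom mat"
  assumes A: "A \<in> carrier_mat m m" and B: "B \<in> carrier_mat n n"
  shows "char_poly (four_block_mat A (0\<^sub>m m n) (0\<^sub>m n m) B) = char_poly A * char_poly B"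
proof -
  have "char_poly_matrix (four_block_mat A (0\<^sub>m m n) (0\<^sub>m n m) B)
      = four_block_mat (char_poly_matrix A) (0\<^sub>m m n) (0\<^sub>m n m) (char_poly_matrix B)"
    using A B by (intro eq_matI) (auto simp: char_poly_matrix_def)
  then show ?thesis
    unfolding char_poly_def using A B
    by (simp add: det_four_block_mat_lower_left_zero[of _ m _ n])
qed

lemma char_poly_adjacency_along_append:
  assumes "\<And>x y. x \<in> set us \<Longrightarrow> y \<in> set vs \<Longrightarrow> (x,y) \<notin> E \<and> (y,x) \<notin> E"
  shows "char_poly (adjacency_along E (us @ vs))
       = char_poly (adjacency_along E us) * char_poly (adjacency_along E vs)"
proof -
  have "adjacency_along E (us @ vs) = four_block_mat (adjacency_along E us)
      (0\<^sub>m (length us) (length vs)) (0\<^sub>m (length vs) (length us)) (adjacency_along E vs)"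
    using assms by (intro eq_matI) (auto simp: adjacency_along_def nth_append)
  then show ?thesis
    using char_poly_block_diagonal[OF adjacency_along_carrier adjacency_along_carrier] by metis
qed

lemma mat_delete_adjacency_along:
  assumes "i < length vs"
  shows "mat_delete (adjacency_along E vs) i i = adjacency_along E (take i vs @ drop (Suc i) vs)"
  using assms by (intro eq_matI) (auto simp: adjacency_along_def mat_delete_def nth_append min_def)

text \<open>The diagonal sign matrix of the two-colouring conjugates the adjacency matrix to its negative,
so the characteristic polynomial is even or odd according to the number of vertices.\<close>

lemma single_parity_char_poly_bipartite:
  assumes two_col: "\<And>x y. (x,y) \<in> E \<Longrightarrow> x \<in> X \<longleftrightarrow> y \<notin> X"
  shows "single_parity (length vs) (char_poly (adjacency_along E vs))"
proof (rule single_parityI)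
  define n where "n = length vs"
  define A where "A = adjacency_along E vs"
  have A: "A \<in> carrier_mat n n" unfolding A_def n_def by (rule adjacency_along_carrier)
  show "degree (char_poly (adjacency_along E vs)) \<le> length vs"
    using degree_monic_char_poly[OF A] by (simp add: A_def n_def)
  fix x
  define s where "s i = (if vs ! i \<in> X then 1 else (-1::real))" for i
  define S where "S = mat_diag n s"
  define M where "M y = - char_matrix A y" for y
  have S: "S \<in> carrier_mat n n" and M: "M y \<in> carrier_mat n n" for y
    using A by (auto simp: S_def M_def)
  have "s i * s i = 1" for i by (simp add: s_def)
  then have "S * S = 1\<^sub>m n" by (simp add: S_def)
  then have "det S * det S = 1" using det_mult[OF S S] by simp
  moreover have "M (- x) = (-1) \<cdot>\<^sub>m (S * M x * S)"
  proof (rule eq_matI)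
    fix i j assume "i < dim_row ((-1) \<cdot>\<^sub>m (S * M x * S))" "j < dim_col ((-1) \<cdot>\<^sub>m (S * M x * S))"
    then have ij: "i < n" "j < n" using S by auto
    have "(S * M x * S) $$ (i,j) = s i * M x $$ (i,j) * s j"
      using ij M by (simp add: S_def mat_diag_mult_left[OF M] mat_diag_mult_right[of _ n n])
    moreover have "M (- x) $$ (i,j) = - (s i * M x $$ (i,j) * s j)"
      using ij A two_col[of "vs ! i" "vs ! j"]
      by (auto simp: M_def char_matrix_def s_def A_def adjacency_along_def n_def)
    ultimately show "M (- x) $$ (i,j) = ((-1) \<cdot>\<^sub>m (S * M x * S)) $$ (i,j)"
      using ij S M[of x] by (simp del: index_mult_mat(1))
  qed (use S M in auto)
  then have "det (M (- x)) = (-1) ^ n * (det S * det (M x) * det S)"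
    using S M by (simp add: det_mult[of _ n])
  ultimately have "det (M (- x)) = (-1) ^ n * det (M x)" by (simp add: mult_ac)
  then show "poly (char_poly (adjacency_along E vs)) (- x)
      = (-1) ^ length vs * poly (char_poly (adjacency_along E vs)) x"
    unfolding M_def char_poly_matrix[OF A, symmetric] by (simp add: A_def n_def)
qed

lemma vertex_list:
  assumes "finite (verts G)"
  shows "distinct (vertex_list G)" and "set (vertex_list G) = verts G"
proof -
  have "\<exists>vs. distinct vs \<and> set vs = verts G" using finite_distinct_list[OF assms] by blast
  from someI_ex[OF this] show "distinct (vertex_list G)" "set (vertex_list G) = verts G"
    unfolding vertex_list_def by auto
qed

lemma length_vertex_list: "finite (verts G) \<Longrightarrow> length (vertex_list G) = card (verts G)"
  using vertex_list[of G] distinct_card by fastforce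

lemma adjacency_mat_along: "adjacency_mat G = adjacency_along (arcs_ends G) (vertex_list G)"
  by (simp add: adjacency_mat_def adjacency_along_def Let_def)

lemma graph_char_poly_along:
  assumes "distinct vs" and "set vs = verts G"
  shows "graph_char_poly G = char_poly (adjacency_along (arcs_ends G) vs)"
proof -
  have "finite (verts G)" using assms(2) by (metis List.finite_set)
  then show ?thesis
    unfolding graph_char_poly_def adjacency_mat_along
    using assms vertex_list by (intro char_poly_adjacency_along_reorder) auto
qed

section \<open>Disjoint unions, the quasi-order and the energy\<close>

text \<open>Numbering the vertices of \<open>G\<close> first and then those of \<open>H\<close> without \<open>v\<close> makes the adjacency matrix
of the union block diagonal.\<close>

lemma graph_char_poly_union_del_vert:
  assumes G: "pair_wf_digraph G" "finite (pverts G)" and H: "pair_wf_digraph H" "finite (pverts H)"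
    and disj: "pverts G \<inter> pverts H = {}"
    and i: "i < card (pverts H)" and v: "vertex_list (with_proj H) ! i = v"
  shows "graph_char_poly (union (with_proj G) (pre_digraph.del_vert (with_proj H) v))
       = char_poly (adjacency_mat (with_proj G)) * char_poly (mat_delete (adjacency_mat (with_proj H)) i i)"
proof -
  define us where "us = vertex_list (with_proj G)"
  define ts where "ts = vertex_list (with_proj H)"
  define vs where "vs = take i ts @ drop (Suc i) ts"
  let ?K = "union (with_proj G) (pre_digraph.del_vert (with_proj H) v)"
  have us: "distinct us" "set us = pverts G"
    using vertex_list[of "with_proj G"] G by (auto simp: us_def)
  have ts: "distinct ts" "set ts = pverts H"
    using vertex_list[of "with_proj H"] H by (auto simp: ts_def)
  have i_ts: "i < length ts" using i H length_vertex_list[of "with_proj H"] by (simp add: ts_def)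
  have split_ts: "ts = take i ts @ v # drop (Suc i) ts"
    using i_ts v id_take_nth_drop unfolding ts_def by metis
  have "distinct (take i ts @ v # drop (Suc i) ts)" using ts(1) split_ts by metis
  then have vs: "distinct vs" "v \<notin> set vs" by (auto simp: vs_def)
  have "set ts = insert v (set vs)" by (subst split_ts) (auto simp: vs_def)
  then have set_vs: "set vs = pverts H - {v}" using ts vs by auto
  have E: "arcs_ends ?K = parcs G \<union> {a \<in> parcs H. fst a \<noteq> v \<and> snd a \<noteq> v}"
    by (auto simp: arcs_ends_conv pre_digraph.del_vert_def)
  have inG: "x \<in> pverts G" "y \<in> pverts G" if "(x,y) \<in> parcs G" for x y
    using that pair_wf_digraph.in_arcsD1[OF G(1)] pair_wf_digraph.in_arcsD2[OF G(1)] by auto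
  have inH: "x \<in> pverts H" "y \<in> pverts H" if "(x,y) \<in> parcs H" for x y
    using that pair_wf_digraph.in_arcsD1[OF H(1)] pair_wf_digraph.in_arcsD2[OF H(1)] by auto
  have "graph_char_poly ?K = char_poly (adjacency_along (arcs_ends ?K) (us @ vs))"
    using us vs set_vs disj
    by (intro graph_char_poly_along) (auto simp: pre_digraph.del_vert_def)
  also have "\<dots> = char_poly (adjacency_along (arcs_ends ?K) us) * char_poly (adjacency_along (arcs_ends ?K) vs)"
  proof (rule char_poly_adjacency_along_append)
    fix x y assume "x \<in> set us" "y \<in> set vs"
    then have "x \<notin> pverts H" "y \<notin> pverts G" using us set_vs disj by auto
    then show "(x,y) \<notin> arcs_ends ?K \<and> (y,x) \<notin> arcs_ends ?K"
      using inG[of x y] inG[of y x] inH[of x y] inH[of y x] unfolding E by blast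
  qed
  also have "adjacency_along (arcs_ends ?K) us = adjacency_along (parcs G) us"
  proof (rule adjacency_along_cong)
    fix x y assume "x \<in> set us"
    then have "x \<notin> pverts H" using us disj by auto
    then show "(x,y) \<in> arcs_ends ?K \<longleftrightarrow> (x,y) \<in> parcs G"
      using inH[of x y] unfolding E by blast
  qed
  also have "adjacency_along (arcs_ends ?K) vs = adjacency_along (parcs H) vs"
  proof (rule adjacency_along_cong)
    fix x y assume "x \<in> set vs" "y \<in> set vs"
    then have "x \<notin> pverts G" "x \<noteq> v" "y \<noteq> v" using set_vs disj by auto
    then show "(x,y) \<in> arcs_ends ?K \<longleftrightarrow> (x,y) \<in> parcs H"
      using inG[of x y] unfolding E by auto
  qed
  also have "\<dots> = mat_delete (adjacency_mat (with_proj H)) i i"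
    unfolding adjacency_mat_along vs_def using mat_delete_adjacency_along[OF i_ts]
    by (simp add: ts_def)
  finally show ?thesis by (simp add: adjacency_mat_along us_def)
qed

text \<open>The numbers \<open>b\<^bsub>2k\<^esub>\<close> cover the coefficients in degrees of the same parity as \<open>m\<close>; the single parity
hypotheses dispose of the others.\<close>

lemma quasi_le_coeff_rotate_poly:
  assumes le: "H \<preceq>\<^sub>b K" and card: "card (verts H) = m" "card (verts K) = m"
    and par: "single_parity m (graph_char_poly H)" "single_parity m (graph_char_poly K)"
  shows "coeff (rotate_poly m (graph_char_poly H)) j \<le> coeff (rotate_poly m (graph_char_poly K)) j"
proof (cases "j \<le> m \<and> even (m - j)")
  case True
  then obtain k where k: "m = j + 2 * k" by (metis evenE le_add_diff_inverse)
  have "b_even L k = coeff (rotate_poly m (graph_char_poly L)) j" if "card (verts L) = m"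
    for L :: "('x, 'y) pre_digraph"
    using that by (simp add: b_even_def coeff_rotate_poly k)
  from this[OF card(1)] this[OF card(2)] show ?thesis
    using le unfolding quasi_le_def by metis
next
  case False
  then have "coeff (rotate_poly m p) j = 0" if "single_parity m p" for p
    using that by (auto simp: coeff_rotate_poly single_parity_def even_diff_nat)
  then show ?thesis using par by simp
qed

lemma vertex_energy_spectral:
  assumes fin: "finite (verts G)" and i: "i < card (verts G)" and v: "vertex_list G ! i = v"
    and dec: "spectral_decomposition (card (verts G)) (adjacency_mat G) U d"
  shows "vertex_energy G v = (\<Sum>k<card (verts G). (U $$ (i,k))\<^sup>2 * \<bar>d k\<bar>)"
proof -
  have "(THE i. i < length (vertex_list G) \<and> vertex_list G ! i = v) = i"
    using i v vertex_list(1)[OF fin] length_vertex_list[OF fin]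
    by (intro the_equality) (auto simp: nth_eq_iff_index_eq)
  then show ?thesis
    unfolding vertex_energy_def Let_def using abs_mat_diagonal_entry[OF dec i] by simp
qed

section \<open>Comparing the energies of two vertices\<close>

theorem theorem4p2:
  fixes G1 G2 :: "'a pair_pre_digraph" and v w :: 'a
  assumes "pair_graph G1" and "pair_graph G2"
    and "bipartite (with_proj G1)" and "bipartite (with_proj G2)"
    and "pverts G1 \<inter> pverts G2 = {}"
    and "w \<in> pverts G2" and "v \<in> pverts G1"
    and "union (with_proj G2) (pre_digraph.del_vert (with_proj G1) v) \<preceq>\<^sub>b
         union (with_proj G1) (pre_digraph.del_vert (with_proj G2) w)"
  shows "vertex_energy (with_proj G2) w \<le> vertex_energy (with_proj G1) v"
proof -
  have spectral_data: "\<exists>i U d. i < card (pverts G) \<and> vertex_list (with_proj G) ! i = x \<and>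
      spectral_decomposition (card (pverts G)) (adjacency_mat (with_proj G)) U d \<and>
      single_parity (card (pverts G)) (char_poly (adjacency_mat (with_proj G))) \<and>
      single_parity (card (pverts G) - 1) (char_poly (mat_delete (adjacency_mat (with_proj G)) i i))"
    if G: "pair_graph G" and bip: "bipartite (with_proj G)" and x: "x \<in> pverts G"
    for G :: "'a pair_pre_digraph" and x
  proof -
    interpret pair_graph G by fact
    let ?vs = "vertex_list (with_proj G)" and ?A = "adjacency_mat (with_proj G)"
    have vs: "distinct ?vs" "set ?vs = pverts G" "length ?vs = card (pverts G)"
      using vertex_list[of "with_proj G"] length_vertex_list[of "with_proj G"] pair_finite_verts by auto
    then obtain i where i: "i < card (pverts G)" "?vs ! i = x" using x by (metis in_set_conv_nth)
    have A: "?A = adjacency_along (parcs G) ?vs" by (simp add: adjacency_mat_along)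
    then have "?A \<in> carrier_mat (card (pverts G)) (card (pverts G))"
      using adjacency_along_carrier vs(3) by metis
    moreover have "transpose_mat ?A = ?A"
      using pair_sym_arcs unfolding A symmetric_def
      by (intro eq_matI) (auto simp: adjacency_along_def dest: symD)
    ultimately obtain U d where "spectral_decomposition (card (pverts G)) ?A U d"
      using spectral_theorem_real_symmetric by blast
    moreover obtain X Y where XY: "X \<inter> Y = {}" "parcs G \<subseteq> X \<times> Y \<union> Y \<times> X"
      using bip unfolding bipartite_def by auto
    have two_col: "a \<in> X \<longleftrightarrow> b \<notin> X" if "(a,b) \<in> parcs G" for a b using that XY by blast
    have "single_parity (card (pverts G)) (char_poly ?A)"
      using single_parity_char_poly_bipartite[OF two_col, where vs = ?vs] vs(3) A by simp
    moreover have "single_parity (card (pverts G) - 1) (char_poly (mat_delete ?A i i))"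
      using single_parity_char_poly_bipartite[OF two_col, where vs = "take i ?vs @ drop (Suc i) ?vs"]
        i vs(3) mat_delete_adjacency_along[of i ?vs] A by simp
    ultimately show ?thesis using i by blast
  qed
  define n1 where "n1 = card (pverts G1)"
  define n2 where "n2 = card (pverts G2)"
  define A1 where "A1 = adjacency_mat (with_proj G1)"
  define A2 where "A2 = adjacency_mat (with_proj G2)"
  obtain i1 U1 d1 where 1: "i1 < n1" "vertex_list (with_proj G1) ! i1 = v"
      "spectral_decomposition n1 A1 U1 d1" "single_parity n1 (char_poly A1)"
      "single_parity (n1 - 1) (char_poly (mat_delete A1 i1 i1))"
    using spectral_data[OF assms(1,3,7)] unfolding n1_def A1_def by blast
  obtain i2 U2 d2 where 2: "i2 < n2" "vertex_list (with_proj G2) ! i2 = w"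
      "spectral_decomposition n2 A2 U2 d2" "single_parity n2 (char_poly A2)"
      "single_parity (n2 - 1) (char_poly (mat_delete A2 i2 i2))"
    using spectral_data[OF assms(2,4,6)] unfolding n2_def A2_def by blast
  interpret G1: pair_graph G1 by fact
  interpret G2: pair_graph G2 by fact
  let ?H = "union (with_proj G2) (pre_digraph.del_vert (with_proj G1) v)"
  let ?K = "union (with_proj G1) (pre_digraph.del_vert (with_proj G2) w)"
  define m where "m = n1 + n2 - 1"
  have m: "m = n2 + (n1 - 1)" "m = n1 + (n2 - 1)" using 1(1) 2(1) by (auto simp: m_def)
  have cards: "card (verts ?H) = m" "card (verts ?K) = m"
    using assms(5-7) G1.pair_finite_verts G2.pair_finite_verts m
    by (auto simp: pre_digraph.del_vert_def n1_def n2_def card_Un_disjoint Int_commute disjoint_iff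
        intro!: card_Un_disjoint[THEN trans])
  have H: "graph_char_poly ?H = char_poly A2 * char_poly (mat_delete A1 i1 i1)"
    unfolding A1_def A2_def using 1 assms(5) G1.pair_finite_verts G2.pair_finite_verts
    by (intro graph_char_poly_union_del_vert) (auto simp: n1_def G1.pair_wf_digraph G2.pair_wf_digraph)
  have K: "graph_char_poly ?K = char_poly A1 * char_poly (mat_delete A2 i2 i2)"
    unfolding A1_def A2_def using 2 assms(5) G1.pair_finite_verts G2.pair_finite_verts
    by (intro graph_char_poly_union_del_vert) (auto simp: n2_def G1.pair_wf_digraph G2.pair_wf_digraph)
  have coeffs: "coeff (rotate_poly m (char_poly A2 * char_poly (mat_delete A1 i1 i1))) j
      \<le> coeff (rotate_poly m (char_poly A1 * char_poly (mat_delete A2 i2 i2))) j" for j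
    using quasi_le_coeff_rotate_poly[OF assms(8) cards, of j]
      single_parity_mult[OF 2(4) 1(5), folded m(1)]
      single_parity_mult[OF 1(4) 2(5), folded m(2)] unfolding H K by simp
  \<comment> \<open>the integrands of Coulson's formula for the two vertices\<close>
  have "(\<Sum>k<n2. (U2 $$ (i2,k))\<^sup>2 * ((d2 k)\<^sup>2 / (x\<^sup>2 + (d2 k)\<^sup>2)))
      \<le> (\<Sum>k<n1. (U1 $$ (i1,k))\<^sup>2 * ((d1 k)\<^sup>2 / (x\<^sup>2 + (d1 k)\<^sup>2)))" if x: "0 < x" for x
  proof -
    define S1 where "S1 = (\<Sum>k<n1. (U1 $$ (i1,k))\<^sup>2 * x / (x\<^sup>2 + (d1 k)\<^sup>2))"
    define S2 where "S2 = (\<Sum>k<n2. (U2 $$ (i2,k))\<^sup>2 * x / (x\<^sup>2 + (d2 k)\<^sup>2))"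
    let ?q1 = "poly (rotate_poly n1 (char_poly A1)) x"
    let ?q2 = "poly (rotate_poly n2 (char_poly A2)) x"
    note q1 = rotated_char_poly_ratio[OF 1(3,1,4,5) x, folded S1_def]
    note q2 = rotated_char_poly_ratio[OF 2(3,1,4,5) x, folded S2_def]
    have "?q2 * (?q1 * S1) \<le> ?q1 * (?q2 * S2)"
      using poly_mono_coeffs[OF coeffs, of x] x q1(2) q2(2)
        poly_rotate_poly_mult[OF 2(4) 1(5), of x, folded m(1)]
        poly_rotate_poly_mult[OF 1(4) 2(5), of x, folded m(2)]
      by simp
    then have "(?q1 * ?q2) * S1 \<le> (?q1 * ?q2) * S2" by (simp add: mult_ac)
    then have "S1 \<le> S2" using q1(1) q2(1) by (simp add: mult_le_cancel_left_pos)
    \<comment> \<open>as the weights sum to one, passing to the complement reverses the inequality between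
      \<open>S1\<close> and \<open>S2\<close>\<close>
    moreover have compl: "(\<Sum>k<n. p k * ((d k)\<^sup>2 / (x\<^sup>2 + (d k)\<^sup>2))) = 1 - x * (\<Sum>k<n. p k * x / (x\<^sup>2 + (d k)\<^sup>2))"
      if "(\<Sum>k<n. p k) = 1" for n and p d :: "nat \<Rightarrow> real"
    proof -
      have "p k * ((d k)\<^sup>2 / (x\<^sup>2 + (d k)\<^sup>2)) = p k - x * (p k * x / (x\<^sup>2 + (d k)\<^sup>2))" for k
      proof -
        have "x\<^sup>2 + (d k)\<^sup>2 \<noteq> 0" using x by (simp add: sum_power2_eq_zero_iff)
        then show ?thesis by (simp add: field_simps power2_eq_square)
      qed
      then show ?thesis using that by (simp add: sum_subtractf sum_distrib_left)
    qed
    ultimately show ?thesis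
      unfolding compl[OF spectral_weights_sum[OF 1(3,1)]] compl[OF spectral_weights_sum[OF 2(3,1)]]
      using x by (simp add: S1_def S2_def)
  qed
  then have "(\<Sum>k<n2. (U2 $$ (i2,k))\<^sup>2 * \<bar>d2 k\<bar>) \<le> (\<Sum>k<n1. (U1 $$ (i1,k))\<^sup>2 * \<bar>d1 k\<bar>)"
    by (rule sum_abs_le_of_sum_lorentzian_le)
  then show ?thesis
    using vertex_energy_spectral[of "with_proj G1" i1 v U1 d1] vertex_energy_spectral[of "with_proj G2" i2 w U2 d2]
      1 2 G1.pair_finite_verts G2.pair_finite_verts by (simp add: n1_def n2_def A1_def A2_def)
qed

end
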